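(* Let $-1<m<0$. Let $0\le u_0\in L^\infty(\mathbb{R})$ satisfy $$u_0(x)\le(\mu_0|m||x|)^{\frac1m}\quad\text{for all }|x|\ge R_0$$ for some constants $\mu_0>0$, $R_0>1$, let $0\le f\in C([0,\infty))$, and let $T$ be given by $$2\int_0^Tf\,ds=\int_{\mathbb{R}}u_0\,dx .$$ Suppose $u$ is a solution of the Cauchy problem $u_t=(u^m/m)_{xx}$ in $\mathbb{R}\times(0,T)$, $u(x,0)=u_0(x)$ in $\mathbb{R}$, which satisfies $$\int_{\mathbb{R}}u(x,t)\,dx=\int_{\mathbb{R}}u_0\,dx-2\int_0^tf\,ds\quad\text{for all }0\le t<T\tag{i}$$ and, for any $0<a<b<T$, $$\frac{u^m(x,t)}{m|x|}\to-f(t)\quad\text{as }|x|\to\infty,\ \text{uniformly in }t\in[a,b].\tag{ii}$$ Let $\tilde u$ be the solution of the same Cauchy problem in $\mathbb{R}\times(0,T)$ constructed by the Neumann approximation (as defined in the context), which also satisfies (i) and (ii) (with $\tilde u$ in place of $u$). Then $u=\tilde u$ in $\mathbb{R}\times(0,T)$.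
   Context: Cauchy solution: for $0\le u_0\in L^1(\mathbb{R})$, $u$ is a solution of $u_t=(u^m/m)_{xx}$ in $\mathbb{R}\times(0,T)$, $u(x,0)=u_0(x)$, if $u>0$ is a classical solution of $u_t=(u^m/m)_{xx}$ in $\mathbb{R}\times(0,T)$ and $u(\cdot,t)\to u_0$ in $L^1(\mathbb{R})$ as $t\to0$. Neumann approximation (known construction of K.M. Hui, Math. Ann. 339 (2007)): for each $R$ let $\tilde u^R>0$ be the solution of $u_t=(u^m/m)_{xx}$ in $(-R,R)\times(0,T_R)$ with $(u^m/m)_x(R,t)=-f(t)$, $(u^m/m)_x(-R,t)=f(t)$ for $0<t<T_R$ and $u(x,0)=u_0(x)$ in $(-R,R)$, where $\int_{-R}^Ru_0\,dx=2\int_0^{T_R}f\,ds$. It is known that $\tilde u^R$ converges, as $R\to\infty$, uniformly on compact subsets of $\mathbb{R}\times(0,T)$ to a solution $\tilde u$ of the Cauchy problem satisfying (i) and (ii); this $\tilde u$ is "the solution constructed by the Neumann approximation". *)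

theory Defs
  imports "HOL-Analysis.Analysis"
begin

text \<open>
  Functions of space and time are curried: \<open>u x t\<close>, with space-time domains as subsets of
  \<open>real \<times> real\<close>.
\<close>

definition C21_on :: "(real \<times> real) set \<Rightarrow> (real \<Rightarrow> real \<Rightarrow> real) \<Rightarrow> bool" where
  "C21_on D u \<longleftrightarrow>
     (\<exists>ux uxx ut.
        (\<forall>(x, t)\<in>D.
           ((\<lambda>y. u y t) has_real_derivative ux x t) (at x) \<and>
           ((\<lambda>y. ux y t) has_real_derivative uxx x t) (at x) \<and>
           ((\<lambda>s. u x s) has_real_derivative ut x t) (at t)) \<and>
        continuous_on D (\<lambda>(x, t). u x t) \<and>
        continuous_on D (\<lambda>(x, t). ux x t) \<and>
        continuous_on D (\<lambda>(x, t). uxx x t) \<and>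
        continuous_on D (\<lambda>(x, t). ut x t))"

text \<open>
  Positive classical solutions of \<open>u_t = (u^m/m)_xx\<close> on an open set \<open>D\<close>. Since \<open>u\<close> is positive and
  \<open>C^{2,1}\<close> there, all the derivatives below exist.
\<close>

definition classical_solution ::
  "real \<Rightarrow> (real \<times> real) set \<Rightarrow> (real \<Rightarrow> real \<Rightarrow> real) \<Rightarrow> bool" where
  "classical_solution m D u \<longleftrightarrow>
     C21_on D u \<and>
     (\<forall>(x, t)\<in>D. u x t > 0 \<and>
        deriv (\<lambda>s. u x s) t = (deriv ^^ 2) (\<lambda>y. u y t powr m / m) x)"

text \<open>
  The initial condition \<open>u(x,0) = u0(x)\<close> on \<open>A\<close>: convergence in \<open>L^1(A)\<close> as \<open>t\<close> decreases to 0. The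
  slice \<open>t = 0\<close>, which lies outside the domain of the equation, is \<open>u0\<close> by convention. The
  nonnegative integral is infinite, not 0, when the difference fails to be in \<open>L^1(A)\<close>.
\<close>

definition initial_condition ::
  "real set \<Rightarrow> (real \<Rightarrow> real \<Rightarrow> real) \<Rightarrow> (real \<Rightarrow> real) \<Rightarrow> bool" where
  "initial_condition A u u0 \<longleftrightarrow>
     (AE x\<in>A in lebesgue. u x 0 = u0 x) \<and>
     ((\<lambda>t. \<integral>\<^sup>+x\<in>A. ennreal \<bar>u x t - u0 x\<bar> \<partial>lebesgue) \<longlongrightarrow> 0) (at_right 0)"

definition cauchy_solution ::
  "real \<Rightarrow> (real \<Rightarrow> real) \<Rightarrow> real \<Rightarrow> (real \<Rightarrow> real \<Rightarrow> real) \<Rightarrow> bool" where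
  "cauchy_solution m u0 T u \<longleftrightarrow>
     classical_solution m (UNIV \<times> {0<..<T}) u \<and> initial_condition UNIV u u0"

text \<open>
  Solutions in \<open>(-R,R) \<times> (0,S)\<close> with \<open>(u^m/m)_x(R,t) = -f(t)\<close> and \<open>(u^m/m)_x(-R,t) = f(t)\<close>. The
  boundary condition is classical: \<open>u > 0\<close> and \<open>(u^m/m)_x\<close> are continuous up to the lateral
  boundary, where the derivative is one-sided.
\<close>

definition neumann_solution ::
  "real \<Rightarrow> (real \<Rightarrow> real) \<Rightarrow> (real \<Rightarrow> real) \<Rightarrow> real \<Rightarrow> real \<Rightarrow> (real \<Rightarrow> real \<Rightarrow> real) \<Rightarrow> bool" where
  "neumann_solution m u0 f R S u \<longleftrightarrow>
     classical_solution m ({-R<..<R} \<times> {0<..<S}) u \<and>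
     continuous_on ({-R..R} \<times> {0<..<S}) (\<lambda>(x, t). u x t) \<and>
     (\<forall>(x, t)\<in>{-R..R} \<times> {0<..<S}. u x t > 0) \<and>
     (\<exists>vx.
        (\<forall>(x, t)\<in>{-R..R} \<times> {0<..<S}.
           ((\<lambda>y. u y t powr m / m) has_real_derivative vx x t) (at x within {-R..R})) \<and>
        continuous_on ({-R..R} \<times> {0<..<S}) (\<lambda>(x, t). vx x t) \<and>
        (\<forall>t\<in>{0<..<S}. vx R t = - f t \<and> vx (-R) t = f t)) \<and>
     initial_condition {-R<..<R} u u0"

text \<open>
  \<open>u\<close> is constructed by the Neumann approximation: it is the limit of the solutions \<open>uR R\<close> in
  \<open>(-R,R) \<times> (0,TR R)\<close>, uniformly on compact subsets of \<open>\<real> \<times> (0,T)\<close>. Radii for which \<open>u0\<close> has no mass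
  in \<open>(-R,R)\<close> are left out, as there \<open>TR R = 0\<close> and the domain of \<open>uR R\<close> is empty.
\<close>

definition neumann_approximation ::
  "real \<Rightarrow> (real \<Rightarrow> real) \<Rightarrow> (real \<Rightarrow> real) \<Rightarrow> real \<Rightarrow> (real \<Rightarrow> real \<Rightarrow> real) \<Rightarrow> bool" where
  "neumann_approximation m u0 f T u \<longleftrightarrow>
     (\<exists>TR uR.
        (\<forall>R>0. (LINT x:{-R<..<R}|lebesgue. u0 x) > 0 \<longrightarrow>
           TR R > 0 \<and>
           (LINT x:{-R<..<R}|lebesgue. u0 x) = 2 * (LINT s:{0..TR R}|lebesgue. f s) \<and>
           neumann_solution m u0 f R (TR R) (uR R)) \<and>
        (\<forall>K. compact K \<and> K \<subseteq> UNIV \<times> {0<..<T} \<longrightarrow>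
           uniform_limit K (\<lambda>R (x, t). uR R x t) (\<lambda>(x, t). u x t) at_top))"

text \<open>Here \<open>has_bochner_integral\<close> includes the integrability of \<open>u(\<cdot>,t)\<close>.\<close>

definition mass_identity ::
  "(real \<Rightarrow> real) \<Rightarrow> (real \<Rightarrow> real) \<Rightarrow> real \<Rightarrow> (real \<Rightarrow> real \<Rightarrow> real) \<Rightarrow> bool" where
  "mass_identity u0 f T u \<longleftrightarrow>
     (\<forall>t. 0 \<le> t \<and> t < T \<longrightarrow>
        has_bochner_integral lebesgue (\<lambda>x. u x t)
          ((LINT x|lebesgue. u0 x) - 2 * (LINT s:{0..t}|lebesgue. f s)))"

text \<open>On the reals, \<open>at_infinity\<close> is the filter \<open>\<bar>x\<bar> \<longrightarrow> \<infinity>\<close>.\<close>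

definition decay_at_infinity ::
  "real \<Rightarrow> (real \<Rightarrow> real) \<Rightarrow> real \<Rightarrow> (real \<Rightarrow> real \<Rightarrow> real) \<Rightarrow> bool" where
  "decay_at_infinity m f T u \<longleftrightarrow>
     (\<forall>a b. 0 < a \<and> a < b \<and> b < T \<longrightarrow>
        uniform_limit {a..b} (\<lambda>x t. u x t powr m / (m * \<bar>x\<bar>)) (\<lambda>t. - f t) at_infinity)"

end

theory Submission
  imports Defs
begin

text \<open>
  The mass \<open>M(x,t)\<close> of \<open>u(\<cdot>,t)\<close> to the left of \<open>x\<close> satisfies \<open>M\<^sub>x = u\<close> and
  \<open>M\<^sub>t = (u^m/m)\<^sub>x - f\<close>. The difference \<open>W\<close> of these masses for two solutions tends to 0 as
  \<open>t \<rightarrow> 0\<close>, by the initial condition, and as \<open>\<bar>x\<bar> \<rightarrow> \<infinity>\<close>, locally uniformly in \<open>t\<close>, since both solutions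
  have the same mass. Where \<open>W\<^sub>x = 0\<close> the two solutions agree, so there \<open>W\<^sub>t = u^(m-1) W\<^sub>x\<^sub>x\<close>, and the
  maximum principle yields \<open>W = 0\<close>.
\<close>

section \<open>The equation in divergence form\<close>

text \<open>Everything later works with the flux \<open>u powr (m - 1) * ux\<close>, which is the
  x-derivative of the pressure \<open>u powr m / m\<close> by the chain rule; the hypothesis on
  \<open>m\<close> cancels the factor \<open>m\<close>. The equation then says that the x-derivative
  of the flux is \<open>ut\<close>.\<close>

lemma classical_solution_pressure:
  assumes "classical_solution m (UNIV \<times> {0<..<T}) u" and "m \<noteq> 0"
  obtains ux ut where
    "\<And>x t. 0 < t \<Longrightarrow> t < T \<Longrightarrow>
       ((\<lambda>y. u y t powr m / m) has_real_derivative u x t powr (m - 1) * ux x t) (at x)"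
    "\<And>x t. 0 < t \<Longrightarrow> t < T \<Longrightarrow> 0 < u x t"
    "\<And>x t. 0 < t \<Longrightarrow> t < T \<Longrightarrow> ((\<lambda>y. u y t) has_real_derivative ux x t) (at x)"
    "\<And>x t. 0 < t \<Longrightarrow> t < T \<Longrightarrow> ((\<lambda>s. u x s) has_real_derivative ut x t) (at t)"
    "\<And>x t. 0 < t \<Longrightarrow> t < T \<Longrightarrow>
       ((\<lambda>y. u y t powr (m - 1) * ux y t) has_real_derivative ut x t) (at x)"
    "continuous_on (UNIV \<times> {0<..<T}) (\<lambda>(x, t). u x t)"
    "continuous_on (UNIV \<times> {0<..<T}) (\<lambda>(x, t). ux x t)"
    "continuous_on (UNIV \<times> {0<..<T}) (\<lambda>(x, t). ut x t)"
proof -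
  from assms(1) obtain ux uxx ut where
      D: "\<forall>(x, t)\<in>UNIV \<times> {0<..<T}.
           ((\<lambda>y. u y t) has_real_derivative ux x t) (at x) \<and>
           ((\<lambda>y. ux y t) has_real_derivative uxx x t) (at x) \<and>
           ((\<lambda>s. u x s) has_real_derivative ut x t) (at t)"
      and C: "continuous_on (UNIV \<times> {0<..<T}) (\<lambda>(x, t). u x t)"
        "continuous_on (UNIV \<times> {0<..<T}) (\<lambda>(x, t). ux x t)"
        "continuous_on (UNIV \<times> {0<..<T}) (\<lambda>(x, t). ut x t)"
    unfolding classical_solution_def C21_on_def by blast
  have pos: "0 < u x t"
    and eq: "deriv (\<lambda>s. u x s) t = (deriv ^^ 2) (\<lambda>y. u y t powr m / m) x"
    if "0 < t" "t < T" for x t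
    using assms(1) that unfolding classical_solution_def by auto
  have Dx: "((\<lambda>y. u y t) has_real_derivative ux x t) (at x)"
    and Dxx: "((\<lambda>y. ux y t) has_real_derivative uxx x t) (at x)"
    and Dt: "((\<lambda>s. u x s) has_real_derivative ut x t) (at t)"
    if "0 < t" "t < T" for x t
    using D that by auto
  have Dv: "((\<lambda>y. u y t powr m / m) has_real_derivative u x t powr (m - 1) * ux x t) (at x)"
    if t: "0 < t" "t < T" for x t
    using DERIV_cdivide[OF DERIV_chain2[OF has_real_derivative_powr[OF pos[OF t]] Dx[OF t]], of m m]
      \<open>m \<noteq> 0\<close> by simp
  have Dp: "((\<lambda>y. u y t powr (m - 1) * ux y t) has_real_derivative ut x t) (at x)"
    if t: "0 < t" "t < T" for x t
  proof -
    let ?p = "\<lambda>y. u y t powr (m - 1) * ux y t"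
    \<comment> \<open>An equality of functions of x, not just of values at \<open>x\<close>, so that
      it can be rewritten inside the outer \<open>deriv\<close> of the second iterate.\<close>
    have dv: "deriv (\<lambda>y. u y t powr m / m) = ?p"
      by (intro ext DERIV_imp_deriv Dv t)
    have "((\<lambda>y. u y t powr (m - 1)) has_real_derivative
        (m - 1) * u x t powr (m - 1 - 1) * ux x t) (at x)"
      by (rule DERIV_chain2[OF has_real_derivative_powr[OF pos[OF t]] Dx[OF t]])
    \<comment> \<open>The product rule yields differentiability of the flux; its explicit value is
      discarded and replaced by \<open>ut\<close> through the equation.\<close>
    note D = DERIV_mult[OF this Dxx[OF t]]
    have "(?p has_real_derivative deriv ?p x) (at x)"
      using D unfolding DERIV_imp_deriv[OF D] .
    moreover have "deriv ?p x = ut x t"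
      using eq[OF t, of x] DERIV_imp_deriv[OF Dt[OF t]] by (simp add: numeral_2_eq_2 dv)
    ultimately show ?thesis by simp
  qed
  show ?thesis by (rule that[OF Dv pos Dx Dt Dp C])
qed

section \<open>Integrals over half-lines\<close>

lemma set_integral_atMost_diff:
  fixes w :: "real \<Rightarrow> real"
  assumes "integrable lebesgue w" "x \<le> y"
  shows "(LINT z:{..y}|lebesgue. w z) - (LINT z:{..x}|lebesgue. w z) = integral {x..y} w"
proof -
  have S: "set_integrable lebesgue A w" if "A \<in> sets lebesgue" for A
    using assms(1) that integrable_mult_indicator unfolding set_integrable_def by blast
  have "{..y} = {..x} \<union> {x<..y}" using assms(2) by auto
  then have "(LINT z:{..y}|lebesgue. w z) =
      (LINT z:{..x}|lebesgue. w z) + (LINT z:{x<..y}|lebesgue. w z)"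
    by (simp only:) (rule set_integral_Un, auto intro!: S)
  also have "(LINT z:{x<..y}|lebesgue. w z) = integral {x<..y} w"
    by (rule set_lebesgue_integral_eq_integral) (simp add: S)
  also have "\<dots> = integral {x..y} w"
  proof (rule integral_spike_set)
    have "{z \<in> {x<..y} - {x..y}. w z \<noteq> 0} \<subseteq> {x}" "{z \<in> {x..y} - {x<..y}. w z \<noteq> 0} \<subseteq> {x}" by auto
    then show "negligible {z \<in> {x<..y} - {x..y}. w z \<noteq> 0}" "negligible {z \<in> {x..y} - {x<..y}. w z \<noteq> 0}"
      by (meson negligible_sing negligible_subset)+
  qed
  finally show ?thesis by simp
qed

text \<open>Moving the base point from minus infinity to \<open>x - 1\<close> adds a constant, after
  which the fundamental theorem of calculus applies on a compact interval with \<open>x\<close> in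
  its interior.\<close>

lemma set_integral_atMost_has_derivative:
  fixes w :: "real \<Rightarrow> real"
  assumes "integrable lebesgue w" "continuous_on UNIV w"
  shows "((\<lambda>x. LINT z:{..x}|lebesgue. w z) has_real_derivative w x) (at x)"
proof -
  have "((\<lambda>y. (LINT z:{..x-1}|lebesgue. w z) + integral {x-1..y} w) has_real_derivative w x)
      (at x within {x-1..x+1})"
    by (auto intro!: derivative_eq_intros integral_has_real_derivative
        intro: continuous_on_subset[OF assms(2)])
  then have "((\<lambda>y. LINT z:{..y}|lebesgue. w z) has_real_derivative w x) (at x within {x-1..x+1})"
  proof (rule has_field_derivative_transform_within[where d=1])
    fix y assume "y \<in> {x-1..x+1}"
    then show "(LINT z:{..x-1}|lebesgue. w z) + integral {x-1..y} w = (LINT z:{..y}|lebesgue. w z)"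
      using set_integral_atMost_diff[OF assms(1), of "x - 1" y] by simp
  qed auto
  then show ?thesis
    by (simp add: at_within_Icc_at)
qed

text \<open>Dominated convergence with dominating function \<open>norm (w z)\<close>.\<close>

lemma integral_symmetric_tendsto:
  fixes w :: "real \<Rightarrow> real"
  assumes "integrable lebesgue w"
  shows "((\<lambda>X. integral {-X..X} w) \<longlongrightarrow> (LINT z|lebesgue. w z)) at_top"
proof -
  have S: "set_integrable lebesgue {-X..X} w" for X
    unfolding set_integrable_def by (rule integrable_mult_indicator) (auto simp: assms)
  have "((\<lambda>X. LINT z|lebesgue. indicator {-X..X} z *\<^sub>R w z) \<longlongrightarrow> (LINT z|lebesgue. w z)) at_top"
  proof (rule integral_dominated_convergence_at_top)
    show "integrable lebesgue (\<lambda>z. norm (w z))" using assms by auto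
    show "w \<in> borel_measurable lebesgue" using assms by auto
    show "(\<lambda>z. indicator {-X..X} z *\<^sub>R w z) \<in> borel_measurable lebesgue" for X
      using S[of X] unfolding set_integrable_def by auto
    show "\<forall>\<^sub>F X in at_top. AE z in lebesgue. norm (indicator {-X..X} z *\<^sub>R w z) \<le> norm (w z)"
      by (auto simp: indicator_def)
    show "AE z in lebesgue. ((\<lambda>X. indicator {-X..X} z *\<^sub>R w z) \<longlongrightarrow> w z) at_top"
    proof (rule AE_I2)
      fix z :: real
      show "((\<lambda>X. indicator {-X..X} z *\<^sub>R w z) \<longlongrightarrow> w z) at_top"
        by (rule tendsto_eventually, rule eventually_at_top_linorderI[of "\<bar>z\<bar>"])
           (auto simp: indicator_def)
    qed
  qed
  then show ?thesis
    using set_lebesgue_integral_eq_integral(2)[OF S] by (simp add: set_lebesgue_integral_def)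
qed

lemma set_integral_atMost_bounds:
  fixes w :: "real \<Rightarrow> real"
  assumes w: "integrable lebesgue w" "\<And>x. 0 \<le> w x"
  shows set_integral_atMost_nonneg: "0 \<le> (LINT z:{..x}|lebesgue. w z)"
    and set_integral_atMost_le_total: "(LINT z:{..x}|lebesgue. w z) \<le> (LINT z|lebesgue. w z)"
    and set_integral_atMost_mono: "x \<le> y \<Longrightarrow> (LINT z:{..x}|lebesgue. w z) \<le> (LINT z:{..y}|lebesgue. w z)"
proof -
  show "0 \<le> (LINT z:{..x}|lebesgue. w z)"
    unfolding set_lebesgue_integral_def by (rule integral_nonneg_AE) (simp add: w)
  have S: "integrable lebesgue (\<lambda>z. indicator {..x} z *\<^sub>R w z)" for x
    by (rule integrable_mult_indicator) (auto simp: w)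
  show "(LINT z:{..x}|lebesgue. w z) \<le> (LINT z|lebesgue. w z)"
    unfolding set_lebesgue_integral_def
    by (rule integral_mono[OF S w(1)]) (auto simp: indicator_def w)
  show "x \<le> y \<Longrightarrow> (LINT z:{..x}|lebesgue. w z) \<le> (LINT z:{..y}|lebesgue. w z)"
    unfolding set_lebesgue_integral_def
    by (rule integral_mono[OF S S]) (auto simp: indicator_def w)
qed

text \<open>The integral over \<open>{-X..X}\<close> is the increment of a monotone function with
  values between 0 and the total mass. Both bounds serve as lateral boundary estimates once little
  mass lies outside \<open>{-X..X}\<close>.\<close>

lemma set_integral_atMost_tail:
  fixes w :: "real \<Rightarrow> real"
  assumes w: "integrable lebesgue w" "\<And>x. 0 \<le> w x" and "0 \<le> X"
  shows "x \<le> -X \<Longrightarrow> (LINT z:{..x}|lebesgue. w z) \<le> (LINT z|lebesgue. w z) - integral {-X..X} w"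
    and "X \<le> x \<Longrightarrow> integral {-X..X} w \<le> (LINT z:{..x}|lebesgue. w z)"
proof -
  have *: "(LINT z:{..X}|lebesgue. w z) - (LINT z:{..-X}|lebesgue. w z) = integral {-X..X} w"
    using set_integral_atMost_diff[OF w(1), of "-X" X] \<open>0 \<le> X\<close> by simp
  show "(LINT z:{..x}|lebesgue. w z) \<le> (LINT z|lebesgue. w z) - integral {-X..X} w" if "x \<le> -X"
    using set_integral_atMost_mono[OF w that] set_integral_atMost_le_total[OF w, of X] * by linarith
  show "integral {-X..X} w \<le> (LINT z:{..x}|lebesgue. w z)" if "X \<le> x"
    using set_integral_atMost_mono[OF w that] set_integral_atMost_nonneg[OF w, of "-X"] * by linarith
qed

lemma set_integral_atMost_tendsto:
  fixes w :: "real \<Rightarrow> real"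
  assumes w: "integrable lebesgue w" "\<And>x. 0 \<le> w x"
  shows "((\<lambda>x. LINT z:{..x}|lebesgue. w z) \<longlongrightarrow> (LINT z|lebesgue. w z)) at_top"
proof (rule tendsto_sandwich[OF _ _ integral_symmetric_tendsto[OF w(1)] tendsto_const])
  show "\<forall>\<^sub>F x in at_top. integral {- x..x} w \<le> (LINT z:{..x}|lebesgue. w z)"
    by (rule eventually_at_top_linorderI[of 0]) (use set_integral_atMost_tail[OF w] in auto)
qed (use set_integral_atMost_le_total[OF w] in auto)

section \<open>A parabolic maximum principle\<close>

text \<open>At an interior spatial maximum of \<open>W\<close> the equation is only used where \<open>W\<^sub>x = 0\<close>,
  and there it gives \<open>W\<^sub>t \<le> 0\<close>.\<close>

lemma parabolic_maximum_principle:
  fixes W w g :: "real \<Rightarrow> real \<Rightarrow> real"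
  assumes "a < b"
    and cont: "continuous_on ({-X..X} \<times> {a..b}) (\<lambda>(x, t). W x t)"
    and Wx: "\<And>x t. a < t \<Longrightarrow> t \<le> b \<Longrightarrow> ((\<lambda>y. W y t) has_real_derivative w x t) (at x)"
    and Wt: "\<And>x t. a < t \<Longrightarrow> t \<le> b \<Longrightarrow> ((\<lambda>s. W x s) has_real_derivative g x t) (at t)"
    and eqn: "\<And>x t. a < t \<Longrightarrow> t \<le> b \<Longrightarrow> w x t = 0 \<Longrightarrow>
       \<exists>d c. ((\<lambda>y. w y t) has_real_derivative d) (at x) \<and> 0 \<le> c \<and> g x t = c * d"
    and init: "\<And>x. x \<in> {-X..X} \<Longrightarrow> W x a \<le> B"
    and side: "\<And>t. t \<in> {a..b} \<Longrightarrow> W (-X) t \<le> B" "\<And>t. t \<in> {a..b} \<Longrightarrow> W X t \<le> B"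
    and x: "x \<in> {-X..X}" and t: "t \<in> {a..b}"
  shows "W x t \<le> B"
proof (rule field_le_epsilon)
  fix e :: real assume "0 < e"
  \<comment> \<open>The penalty \<open>k * (t - a)\<close> makes the time inequality at a maximum
    strict and costs at most \<open>e\<close> on the whole time interval.\<close>
  define k where "k = e / (b - a)"
  have k: "0 < k" "k * (b - a) = e" using \<open>0 < e\<close> \<open>a < b\<close> by (auto simp: k_def)
  define V where "V x t = W x t - k * (t - a)" for x t
  have "continuous_on ({-X..X} \<times> {a..b}) (\<lambda>q. V (fst q) (snd q))"
    using cont unfolding V_def by (auto intro!: continuous_intros simp: case_prod_unfold)
  moreover have "compact ({-X..X} \<times> {a..b})" by (intro compact_Times compact_Icc)
  ultimately obtain q where q: "q \<in> {-X..X} \<times> {a..b}"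
      "\<And>r. r \<in> {-X..X} \<times> {a..b} \<Longrightarrow> V (fst r) (snd r) \<le> V (fst q) (snd q)"
    using continuous_attains_sup[of "{-X..X} \<times> {a..b}" "\<lambda>q. V (fst q) (snd q)"] x t by blast
  obtain x1 t1 where [simp]: "q = (x1, t1)" by (cases q)
  have mem: "x1 \<in> {-X..X}" "t1 \<in> {a..b}" using q(1) by auto
  have max: "V y s \<le> V x1 t1" if "y \<in> {-X..X}" "s \<in> {a..b}" for y s
    using q(2)[of "(y, s)"] that by auto
  have "V x1 t1 \<le> B"
  proof (rule ccontr)
    assume "\<not> V x1 t1 \<le> B"
    \<comment> \<open>A value above \<open>B\<close> excludes the initial line and both lateral
      sides; the final time \<open>b\<close> remains possible.\<close>
    then have "B < W x1 t1" using k mem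
      by (auto simp: V_def) (smt (verit) mult_nonneg_nonneg)
    then have in1: "a < t1" "t1 \<le> b" "-X < x1" "x1 < X"
      using init[OF mem(1)] side[OF mem(2)] mem by (auto simp: less_le)
    have Wmax: "W y t1 \<le> W x1 t1" if "y \<in> {-X..X}" for y
      using max[of y t1] that mem by (simp add: V_def)
    define \<delta> where "\<delta> = min (X - x1) (x1 + X)"
    have "\<delta> > 0" using in1 by (auto simp: \<delta>_def)
    have w0: "w x1 t1 = 0"
      by (rule DERIV_local_max[OF Wx \<open>\<delta> > 0\<close>]) (use in1 Wmax in \<open>auto simp: \<delta>_def abs_less_iff\<close>)
    from eqn[OF in1(1,2) w0] obtain d c where
      d: "((\<lambda>y. w y t1) has_real_derivative d) (at x1)" and c: "0 \<le> c" "g x1 t1 = c * d" by blast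
    \<comment> \<open>Second derivative test: as \<open>w\<close> vanishes at \<open>x1\<close>, a
      positive \<open>d\<close> would make \<open>w\<close> positive just to the right, and
      \<open>W\<close> would rise above its maximum.\<close>
    have "d \<le> 0"
    proof (rule ccontr)
      assume "\<not> d \<le> 0"
      then obtain h where h: "h > 0" "\<And>z. 0 < z \<Longrightarrow> z < h \<Longrightarrow> 0 < w (x1 + z) t1"
        using DERIV_pos_inc_right[OF d] w0 by auto
      define z where "z = min h \<delta> / 2"
      have z: "0 < z" "z < h" "z < \<delta>" using h \<open>\<delta> > 0\<close> by (auto simp: z_def)
      have "W x1 t1 < W (x1 + z) t1"
      proof (rule DERIV_pos_imp_increasing_open[where f="\<lambda>y. W y t1"])
        show "x1 < x1 + z" using z by simp
        show "\<exists>D. DERIV (\<lambda>y. W y t1) y :> D \<and> D > 0" if "x1 < y" "y < x1 + z" for y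
          using Wx[OF in1(1,2)] h(2)[of "y - x1"] z that by force
        show "continuous_on {x1..x1 + z} (\<lambda>y. W y t1)"
          using Wx[OF in1(1,2)] by (meson DERIV_isCont continuous_at_imp_continuous_on)
      qed
      moreover have "W (x1 + z) t1 \<le> W x1 t1"
        using Wmax[of "x1 + z"] z in1 by (auto simp: \<delta>_def)
      ultimately show False by simp
    qed
    then have "g x1 t1 \<le> 0" using c by (simp add: mult_nonneg_nonpos)
    then have neg: "g x1 t1 - k < 0" using k by simp
    have "((\<lambda>s. V x1 s) has_real_derivative g x1 t1 - k) (at t1)"
      unfolding V_def by (auto intro!: derivative_eq_intros Wt in1)
    \<comment> \<open>Only times before \<open>t1\<close> are compared, so \<open>t1 = b\<close>
      needs no separate treatment.\<close>
    from DERIV_neg_dec_left[OF this neg] obtain h where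
      h: "h > 0" "\<And>z. 0 < z \<Longrightarrow> z < h \<Longrightarrow> V x1 t1 < V x1 (t1 - z)" by auto
    define z where "z = min h (t1 - a) / 2"
    have "0 < z" "z < h" "a \<le> t1 - z" using h in1 by (auto simp: z_def min_def field_simps)
    with h(2)[of z] max[of x1 "t1 - z"] mem in1 show False by auto
  qed
  then have "V x t \<le> B" using max[OF x t] by simp
  moreover have "k * (t - a) \<le> e" using k t by (smt (verit) atLeastAtMost_iff mult_left_mono)
  ultimately show "W x t \<le> B + e" by (simp add: V_def)
qed

section \<open>The mass to the left of a point\<close>

definition mass_left_of :: "(real \<Rightarrow> real \<Rightarrow> real) \<Rightarrow> real \<Rightarrow> real \<Rightarrow> real" where
  "mass_left_of u x t = (LINT z:{..x}|lebesgue. u z t)"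

text \<open>Collects the properties that two solutions share at positive times. The total mass
  \<open>N\<close> is a parameter, so that both can be instantiated with the same \<open>N\<close>,
  and \<open>mass_loss\<close> says in integrated form that mass is lost at rate
  \<open>2 f\<close>.\<close>

locale mass_losing_flow =
  fixes m T :: real and f N :: "real \<Rightarrow> real" and u ux ut :: "real \<Rightarrow> real \<Rightarrow> real"
  assumes pos: "0 < t \<Longrightarrow> t < T \<Longrightarrow> 0 < u x t"
    and pressure_x: "0 < t \<Longrightarrow> t < T \<Longrightarrow>
       ((\<lambda>y. u y t powr m / m) has_real_derivative u x t powr (m - 1) * ux x t) (at x)"
    and u_x: "0 < t \<Longrightarrow> t < T \<Longrightarrow> ((\<lambda>y. u y t) has_real_derivative ux x t) (at x)"
    and u_t: "0 < t \<Longrightarrow> t < T \<Longrightarrow> ((\<lambda>s. u x s) has_real_derivative ut x t) (at t)"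
    and flux_x: "0 < t \<Longrightarrow> t < T \<Longrightarrow>
       ((\<lambda>y. u y t powr (m - 1) * ux y t) has_real_derivative ut x t) (at x)"
    and cont_u: "continuous_on (UNIV \<times> {0<..<T}) (\<lambda>(x, t). u x t)"
    and cont_ux: "continuous_on (UNIV \<times> {0<..<T}) (\<lambda>(x, t). ux x t)"
    and cont_ut: "continuous_on (UNIV \<times> {0<..<T}) (\<lambda>(x, t). ut x t)"
    and mass: "0 < t \<Longrightarrow> t < T \<Longrightarrow> has_bochner_integral lebesgue (\<lambda>x. u x t) (N t)"
    and mass_loss: "0 < s \<Longrightarrow> s \<le> t \<Longrightarrow> t < T \<Longrightarrow> N t - N s = - 2 * integral {s..t} f"
    and cont_f: "continuous_on {0..} f"
    and decay: "decay_at_infinity m f T u"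
begin

abbreviation "flux x t \<equiv> u x t powr (m - 1) * ux x t"

lemma integrable_u: "0 < t \<Longrightarrow> t < T \<Longrightarrow> integrable lebesgue (\<lambda>x. u x t)"
  and integral_u: "0 < t \<Longrightarrow> t < T \<Longrightarrow> (LINT x|lebesgue. u x t) = N t"
  using mass by (auto simp: has_bochner_integral_iff)

lemma cont_flux: "continuous_on (UNIV \<times> {0<..<T}) (\<lambda>(x, t). flux x t)"
  using cont_u cont_ux pos unfolding case_prod_unfold
  by (intro continuous_intros) (auto, metis less_irrefl)

lemma cont_pressure: "continuous_on (UNIV \<times> {0<..<T}) (\<lambda>(x, t). u x t powr m / m)"
proof (cases "m = 0")
  case False
  then show ?thesis
    using cont_u pos unfolding case_prod_unfold
    by (intro continuous_intros) (auto, metis less_irrefl)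
\<comment> \<open>For \<open>m = 0\<close> division by zero makes the function constantly 0.\<close>
qed auto

lemma cont_time_slice:
  fixes h :: "real \<Rightarrow> real \<Rightarrow> real"
  assumes h: "continuous_on (UNIV \<times> {0<..<T}) (\<lambda>(x, t). h x t)" and st: "0 < s" "t < T"
  shows "continuous_on {s..t} (h x)"
proof -
  have "continuous_on {s..t} (\<lambda>\<tau>. case (x, \<tau>) of (x, t) \<Rightarrow> h x t)"
    by (rule continuous_on_compose2[OF h]) (use st in \<open>auto intro!: continuous_intros\<close>)
  then show ?thesis by simp
qed

lemma mass_left_of_x:
  assumes "0 < t" "t < T"
  shows "((\<lambda>y. mass_left_of u y t) has_real_derivative u x t) (at x)"
  unfolding mass_left_of_def
proof (rule set_integral_atMost_has_derivative[OF integrable_u[OF assms]])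
  show "continuous_on UNIV (\<lambda>x. u x t)"
    using u_x[OF assms] by (meson DERIV_isCont continuous_at_imp_continuous_on)
qed

text \<open>Integrating the equation in time shows the claim up to a constant in \<open>x\<close>, the flux
  through \<open>-\<infinity>\<close>. By l'Hopital that constant is read off from the linear growth of the pressure at
  \<open>+\<infinity>\<close>, where the mass to the left is the total mass.\<close>

lemma mass_left_of_diff:
  assumes st: "0 < s" "s < t" "t < T"
  shows "mass_left_of u x t - mass_left_of u x s = integral {s..t} (\<lambda>\<tau>. flux x \<tau> - f \<tau>)"
proof -
  have sub: "UNIV \<times> cbox s t \<subseteq> UNIV \<times> {0<..<T}" using st by auto
  note line = cont_time_slice[OF _ st(1,3)]
  \<comment> \<open>Time integrals of the flux and of the pressure. Differentiating under the
    integral gives \<open>E' = D\<close>, and \<open>D'\<close> is the integral of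
    \<open>ut\<close>, that is \<open>u y t - u y s\<close>.\<close>
  define D where "D y = integral {s..t} (flux y)" for y
  define E where "E y = integral {s..t} (\<lambda>\<tau>. u y \<tau> powr m / m)" for y
  have Ex: "(E has_real_derivative D y) (at y)" for y
    unfolding E_def[abs_def] D_def cbox_interval[symmetric]
  proof (rule leibniz_rule_field_derivative)
    show "continuous_on (UNIV \<times> cbox s t) (\<lambda>(x, t). flux x t)"
      by (rule continuous_on_subset[OF cont_flux sub])
  qed (use st line[OF cont_pressure] in \<open>auto intro: integrable_continuous_real pressure_x\<close>)
  have "(D has_real_derivative integral {s..t} (ut y)) (at y)" for y
    unfolding D_def[abs_def] cbox_interval[symmetric]
  proof (rule leibniz_rule_field_derivative)
    show "continuous_on (UNIV \<times> cbox s t) (\<lambda>(x, t). ut x t)"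
      by (rule continuous_on_subset[OF cont_ut sub])
  qed (use st line[OF cont_flux] in \<open>auto intro: integrable_continuous_real flux_x\<close>)
  moreover have "integral {s..t} (ut y) = u y t - u y s" for y
    by (intro integral_unique fundamental_theorem_of_calculus)
       (use st u_t in \<open>auto simp: has_real_derivative_iff_has_vector_derivative[symmetric]
          intro: has_field_derivative_at_within\<close>)
  ultimately have Dx: "(D has_real_derivative u y t - u y s) (at y)" for y
    by simp
  \<comment> \<open>Both the mass increment and \<open>D\<close> have x-derivative
    \<open>u y t - u y s\<close>, so \<open>c\<close> does not depend on the point. It remains to
    identify it.\<close>
  define c where "c = mass_left_of u x t - mass_left_of u x s - D x"
  have c: "mass_left_of u y t - mass_left_of u y s - D y = c" for y
    unfolding c_def
    by (rule DERIV_isconst_all) (use st in \<open>auto intro!: derivative_eq_intros mass_left_of_x Dx\<close>)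
  have lim: "((\<lambda>y. mass_left_of u y \<tau>) \<longlongrightarrow> N \<tau>) at_top" if "0 < \<tau>" "\<tau> < T" for \<tau>
    using set_integral_atMost_tendsto[OF integrable_u[OF that]] pos[OF that] integral_u[OF that]
    by (simp add: mass_left_of_def less_imp_le)
  have "((\<lambda>y. mass_left_of u y t - mass_left_of u y s - c) \<longlongrightarrow> N t - N s - c) at_top"
    using st by (intro tendsto_intros lim) auto
  moreover have "(\<lambda>y. mass_left_of u y t - mass_left_of u y s - c) = D"
    using c by (auto simp: algebra_simps)
  ultimately have "(D \<longlongrightarrow> N t - N s - c) at_top" by simp
  \<comment> \<open>The limit of \<open>D = E'\<close> is passed on to \<open>E y / y\<close>,
    because the decay condition controls the pressure and not its derivative.\<close>
  then have lim1: "((\<lambda>y. E y / y) \<longlongrightarrow> N t - N s - c) at_top"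
    by (intro lhospital_at_top_at_top[where f=E and g="\<lambda>y. y" and f'=D and g'="\<lambda>_. 1"])
       (simp_all add: Ex filterlim_ident)
  \<comment> \<open>Uniformity in time permits integrating the decay condition over
    \<open>{s..t}\<close>, which gives a second expression for the limit of
    \<open>E y / y\<close>.\<close>
  have "uniform_limit {s..t} (\<lambda>y \<tau>. u y \<tau> powr m / (m * \<bar>y\<bar>)) (\<lambda>\<tau>. - f \<tau>) at_top"
    using decay st unfolding decay_at_infinity_def
    by (intro filterlim_mono[OF _ order_refl at_top_le_at_infinity]) simp
  moreover have "continuous_on {s..t} (\<lambda>\<tau>. u y \<tau> powr m / (m * \<bar>y\<bar>))" for y
    using continuous_on_mult[OF line[OF cont_pressure, of y] continuous_on_const[of _ "1 / \<bar>y\<bar>"]] by simp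
  ultimately obtain I J where
    IJ: "\<And>y. ((\<lambda>\<tau>. u y \<tau> powr m / (m * \<bar>y\<bar>)) has_integral I y) {s..t}"
      "((\<lambda>\<tau>. - f \<tau>) has_integral J) {s..t}" "(I \<longlongrightarrow> J) at_top"
    by (rule uniform_limit_integral) (rule trivial_limit_at_top_linorder, blast)
  have "I y = E y / y" if "y > 0" for y
  proof -
    have "I y = integral {s..t} (\<lambda>\<tau>. u y \<tau> powr m / m * (1 / y))"
      using integral_unique[OF IJ(1)[of y]] that by simp
    then show ?thesis unfolding E_def by (simp only: integral_mult_left) simp
  qed
  then have "\<forall>\<^sub>F y in at_top. I y = E y / y"
    by (intro eventually_at_top_linorderI[of 1]) auto
  with IJ(3) have "((\<lambda>y. E y / y) \<longlongrightarrow> J) at_top"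
    by (rule Lim_transform_eventually)
  with lim1 have "N t - N s - c = J"
    using tendsto_unique trivial_limit_at_top_linorder by blast
  moreover have "J = - integral {s..t} f"
    using integral_unique[OF IJ(2)] by simp
  \<comment> \<open>The total loss is twice the integral of \<open>f\<close>, and the end at plus
    infinity accounts for one half; \<open>c\<close> is the other half, lost at minus
    infinity.\<close>
  ultimately have "c = - integral {s..t} f"
    using mass_loss[of s t] st by simp
  moreover have "integral {s..t} (\<lambda>\<tau>. flux x \<tau> - f \<tau>) = D x - integral {s..t} f"
    unfolding D_def using st
    by (intro integral_diff integrable_continuous_real line[OF cont_flux] continuous_on_subset[OF cont_f]) auto
  ultimately show ?thesis by (simp add: c_def)
qed

text \<open>The time-integrated identity, started at some \<open>a\<close> between 0 and
  \<open>t\<close>, is differentiated in its upper limit.\<close>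

lemma mass_left_of_t:
  assumes t: "0 < t" "t < T"
  shows "((\<lambda>s. mass_left_of u x s) has_real_derivative flux x t - f t) (at t)"
proof -
  define a b where "a = t / 2" and "b = (t + T) / 2"
  have ab: "0 < a" "a < t" "t < b" "b < T" using t by (auto simp: a_def b_def)
  have "continuous_on {a..b} (\<lambda>\<tau>. flux x \<tau> - f \<tau>)"
  proof (intro continuous_on_diff)
    show "continuous_on {a..b} (\<lambda>\<tau>. flux x \<tau>)"
      using ab by (intro cont_time_slice[OF cont_flux]) auto
    show "continuous_on {a..b} f" using ab by (intro continuous_on_subset[OF cont_f]) auto
  qed
  from integral_has_real_derivative[OF this, of t] ab
  have "((\<lambda>s. mass_left_of u x a + integral {a..s} (\<lambda>\<tau>. flux x \<tau> - f \<tau>))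
      has_real_derivative flux x t - f t) (at t within {a..b})"
    by (auto intro!: derivative_eq_intros)
  then have "((\<lambda>s. mass_left_of u x s) has_real_derivative flux x t - f t) (at t within {a..b})"
  \<comment> \<open>This radius forces \<open>a < s\<close>, as \<open>mass_left_of_diff\<close>
    requires a strict inequality of times.\<close>
  proof (rule has_field_derivative_transform_within[where d="t - a"])
    fix s assume "s \<in> {a..b}" "dist s t < t - a"
    then have "a < s" "s < T" using ab by (auto simp: dist_real_def)
    then show "mass_left_of u x a + integral {a..s} (\<lambda>\<tau>. flux x \<tau> - f \<tau>) = mass_left_of u x s"
      using mass_left_of_diff[of a s x] ab by simp
  qed (use ab in auto)
  then show ?thesis using ab by (simp add: at_within_Icc_at)
qed

text \<open>The two partial derivatives alone do not give joint continuity at once. Instead the mass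
  is split at 0, and the integral of \<open>u\<close> from 0 to \<open>x\<close> is rescaled to the
  fixed interval from 0 to 1, where continuity in the parameters is available.\<close>

lemma cont_mass_left_of: "continuous_on (UNIV \<times> {0<..<T}) (\<lambda>(x, t). mass_left_of u x t)"
proof -
  have eq: "mass_left_of u x t = mass_left_of u 0 t + integral (cbox 0 1) (\<lambda>\<theta>. x * u (\<theta> * x) t)"
    if "0 < t" "t < T" for x t
  proof -
    have "((\<lambda>\<theta>. x * u (\<theta> * x) t) has_integral mass_left_of u (1 * x) t - mass_left_of u (0 * x) t) {0..1}"
    proof (rule fundamental_theorem_of_calculus[where f="\<lambda>\<theta>. mass_left_of u (\<theta> * x) t"])
      fix \<theta> :: real
      have "((\<lambda>\<theta>. \<theta> * x) has_real_derivative x) (at \<theta>)"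
        using DERIV_cmult_right[OF DERIV_ident, of x] by simp
      from DERIV_chain2[OF mass_left_of_x[OF that] this]
      have "((\<lambda>\<theta>. mass_left_of u (\<theta> * x) t) has_real_derivative x * u (\<theta> * x) t) (at \<theta>)"
        by (simp only: mult.commute)
      then show "((\<lambda>\<theta>. mass_left_of u (\<theta> * x) t) has_vector_derivative x * u (\<theta> * x) t)
          (at \<theta> within {0..1})"
        unfolding has_real_derivative_iff_has_vector_derivative[symmetric]
        by (rule has_field_derivative_at_within)
    qed simp
    from integral_unique[OF this] show ?thesis by (simp del: integral_mult_right)
  qed
  have "continuous_on {0<..<T} (\<lambda>t. mass_left_of u 0 t)"
  proof (rule continuous_at_imp_continuous_on, rule ballI)
    fix t assume "t \<in> {0<..<T}"
    then show "isCont (\<lambda>t. mass_left_of u 0 t) t"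
      using DERIV_isCont[OF mass_left_of_t[of t 0]] by simp
  qed
  then have c0: "continuous_on (UNIV \<times> {0<..<T}) (\<lambda>q::real \<times> real. mass_left_of u 0 (snd q))"
    by (rule continuous_on_compose2) (auto intro!: continuous_intros)
  have "continuous_on ((UNIV \<times> {0<..<T}) \<times> cbox 0 1) (\<lambda>q. u (snd q * fst (fst q)) (snd (fst q)))"
    by (rule continuous_on_compose2[OF cont_u[unfolded case_prod_unfold],
          where f="\<lambda>q. (snd q * fst (fst q), snd (fst q))", simplified])
       (auto intro!: continuous_intros)
  then have "continuous_on ((UNIV \<times> {0<..<T}) \<times> cbox 0 1)
      (\<lambda>(q, \<theta>). fst q * u (\<theta> * fst q) (snd q))"
    unfolding case_prod_unfold by (intro continuous_intros)
  from integral_continuous_on_param[OF this] c0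
  have "continuous_on (UNIV \<times> {0<..<T}) (\<lambda>q. mass_left_of u 0 (snd q) +
      integral (cbox 0 1) (\<lambda>\<theta>. fst q * u (\<theta> * fst q) (snd q)))"
    by (intro continuous_on_add)
  then show ?thesis
  proof (rule continuous_on_eq)
    fix q :: "real \<times> real" assume "q \<in> UNIV \<times> {0<..<T}"
    then have "0 < snd q" "snd q < T" by auto
    from eq[OF this, of "fst q"]
    show "mass_left_of u 0 (snd q) + integral (cbox 0 1) (\<lambda>\<theta>. fst q * u (\<theta> * fst q) (snd q)) =
        (case q of (x, t) \<Rightarrow> mass_left_of u x t)"
      by (simp only: case_prod_unfold)
  qed
qed

text \<open>Dini's argument: the masses of \<open>{-n..n}\<close> increase to the continuous limit \<open>N\<close>.\<close>

lemma uniform_tail: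
  assumes ab: "0 < a" "a \<le> b" "b < T" and "0 < e"
  obtains X where "0 < X" "\<And>Y t. X \<le> Y \<Longrightarrow> t \<in> {a..b} \<Longrightarrow> N t - integral {-Y..Y} (\<lambda>x. u x t) < e"
proof -
  \<comment> \<open>The mass outside \<open>{-Y..Y}\<close>: it decreases in \<open>Y\<close>, tends
    to 0 at each time, and is continuous in time.\<close>
  define R where "R Y t = N t - integral {-Y..Y} (\<lambda>x. u x t)" for Y t
  have R_antimono: "R Y t \<le> R X t" if "X \<le> Y" "t \<in> {a..b}" for X Y t
  proof -
    have t: "0 < t" "t < T" using that ab by auto
    have "continuous_on A (\<lambda>x. u x t)" for A
      using u_x[OF t] by (meson DERIV_isCont continuous_at_imp_continuous_on)
    then show ?thesis
      using that pos[OF t] unfolding R_def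
      by (intro diff_left_mono integral_subset_le integrable_continuous_real) (auto intro: less_imp_le)
  qed
  have R_lim: "((\<lambda>X. R X t) \<longlongrightarrow> 0) at_top" if "t \<in> {a..b}" for t
  proof -
    have t: "0 < t" "t < T" using that ab by auto
    have "((\<lambda>X. R X t) \<longlongrightarrow> N t - N t) at_top"
      unfolding R_def using integral_symmetric_tendsto[OF integrable_u[OF t]] integral_u[OF t]
      by (intro tendsto_intros) simp
    then show ?thesis by simp
  qed
  have R_cont: "continuous_on {a..b} (R X)" for X
  proof -
    \<comment> \<open>Continuity of \<open>N\<close> comes from \<open>mass_loss\<close> relative to
      the time \<open>a\<close>.\<close>
    have "continuous_on {a..b} (\<lambda>t. N a - 2 * integral {a..t} f)"
      by (intro continuous_intros indefinite_integral_continuous_1 integrable_continuous_real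
          continuous_on_subset[OF cont_f]) (use ab in auto)
    then have "continuous_on {a..b} N"
      by (rule continuous_on_eq) (use mass_loss[of a] ab in force)
    moreover have "continuous_on {a..b} (\<lambda>t. integral (cbox (-X) X) (\<lambda>x. u x t))"
    proof (rule integral_continuous_on_param)
      show "continuous_on ({a..b} \<times> cbox (-X) X) (\<lambda>(t, x). u x t)"
        unfolding case_prod_unfold
        by (rule continuous_on_compose2[OF cont_u[unfolded case_prod_unfold],
              where f="\<lambda>q. (snd q, fst q)", simplified])
           (use ab in \<open>auto intro!: continuous_intros\<close>)
    qed
    ultimately show ?thesis unfolding R_def[abs_def] by (auto intro!: continuous_intros)
  qed
  have "\<exists>n::nat. \<forall>t\<in>{a..b}. R (real n) t < e"
  proof (rule ccontr)
    assume "\<not> ?thesis"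
    then obtain \<tau> where \<tau>: "\<And>n::nat. \<tau> n \<in> {a..b}" "\<And>n::nat. e \<le> R (real n) (\<tau> n)"
      by (metis not_less)
    obtain l r where l: "l \<in> {a..b}" "strict_mono r" "(\<tau> \<circ> r) \<longlonglongrightarrow> l"
      using compact_Icc[of a b] \<tau>(1) unfolding compact_def by blast
    \<comment> \<open>Monotonicity freezes the radius: for n beyond \<open>k\<close>, the tail
      outside \<open>k\<close> at the time with index \<open>r n\<close> is at least the tail
      outside \<open>r n\<close>, hence at least \<open>e\<close>. First n tends to infinity with
      \<open>k\<close> fixed, and then \<open>k\<close> does.\<close>
    have "e \<le> R (real k) l" for k
    proof (rule tendsto_lowerbound)
      show "(\<lambda>n. R (real k) ((\<tau> \<circ> r) n)) \<longlonglongrightarrow> R (real k) l"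
        by (rule continuous_on_tendsto_compose[OF R_cont l(3,1)]) (use \<tau>(1) in auto)
      show "\<forall>\<^sub>F n in sequentially. e \<le> R (real k) ((\<tau> \<circ> r) n)"
      proof (rule eventually_sequentiallyI[of k])
        fix n assume "k \<le> n"
        then have "k \<le> r n" using seq_suble[OF l(2), of n] by linarith
        then show "e \<le> R (real k) ((\<tau> \<circ> r) n)"
          using \<tau>(2)[of "r n"] R_antimono[of "real k" "real (r n)" "\<tau> (r n)"] \<tau>(1) by force
      qed
    qed simp
    moreover have "(\<lambda>k. R (real k) l) \<longlonglongrightarrow> 0"
      by (rule filterlim_compose[OF R_lim[OF l(1)] filterlim_real_sequentially])
    ultimately have "e \<le> 0"
      by (intro tendsto_lowerbound[where F=sequentially]) auto
    with \<open>0 < e\<close> show False by simp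
  qed
  then obtain n :: nat where n: "\<And>t. t \<in> {a..b} \<Longrightarrow> R (real n) t < e" by blast
  show ?thesis
  \<comment> \<open>Adding 1 keeps the radius positive when \<open>n\<close> is 0.\<close>
  proof (rule that[of "real n + 1"])
    show "N t - integral {-Y..Y} (\<lambda>x. u x t) < e" if "real n + 1 \<le> Y" "t \<in> {a..b}" for Y t
      using n[OF that(2)] R_antimono[of "real n" Y t] that by (auto simp: R_def)
  qed simp
qed

end

section \<open>Comparison of two solutions\<close>

text \<open>For every \<open>e\<close> the maximum principle bounds the difference of the masses by
  \<open>e\<close> on a suitable rectangle. Its initial time \<open>a\<close> is chosen first, by
  the closeness in L1, and then its width, because tails are small uniformly only on time intervals
  away from 0.\<close>

lemma mass_left_of_le:
  assumes "mass_losing_flow m T f N u ux ut" and "mass_losing_flow m T f N v vx vt"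
    and init: "\<And>e. 0 < e \<Longrightarrow> \<forall>\<^sub>F t in at_right 0. (LINT x|lebesgue. \<bar>u x t - v x t\<bar>) < e"
    and t: "0 < t" "t < T"
  shows "mass_left_of u x t \<le> mass_left_of v x t"
proof -
  interpret U: mass_losing_flow m T f N u ux ut by fact
  interpret V: mass_losing_flow m T f N v vx vt by fact
  have "mass_left_of u x t - mass_left_of v x t \<le> e" if "0 < e" for e
  proof -
    have "\<forall>\<^sub>F a in at_right 0. (LINT x|lebesgue. \<bar>u x a - v x a\<bar>) < e \<and> a \<in> {0<..<t}"
      by (intro eventually_conj init \<open>0 < e\<close> eventually_at_right_real t)
    then obtain a where a: "0 < a" "a < t" "(LINT x|lebesgue. \<bar>u x a - v x a\<bar>) < e"
      using eventually_happens'[OF trivial_limit_at_right_real] by force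
    have "a < T" using a t by simp
    obtain X1 where X1: "0 < X1"
      "\<And>Y s. X1 \<le> Y \<Longrightarrow> s \<in> {a..t} \<Longrightarrow> N s - integral {-Y..Y} (\<lambda>x. u x s) < e"
      using U.uniform_tail[of a t e] a t \<open>0 < e\<close> by auto
    obtain X2 where X2: "0 < X2"
      "\<And>Y s. X2 \<le> Y \<Longrightarrow> s \<in> {a..t} \<Longrightarrow> N s - integral {-Y..Y} (\<lambda>x. v x s) < e"
      using V.uniform_tail[of a t e] a t \<open>0 < e\<close> by auto
    \<comment> \<open>Including the absolute value of \<open>x\<close> places the given point in the
      rectangle.\<close>
    define X where "X = Max {X1, X2, \<bar>x\<bar>}"
    have X: "X1 \<le> X" "X2 \<le> X" "\<bar>x\<bar> \<le> X" "0 \<le> X" using X1(1) by (auto simp: X_def)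
    show ?thesis
    proof (rule parabolic_maximum_principle[where a=a and b=t and X=X and x=x and t=t
          and W="\<lambda>x t. mass_left_of u x t - mass_left_of v x t"
          and w="\<lambda>x t. u x t - v x t" and g="\<lambda>x t. (U.flux x t - f t) - (V.flux x t - f t)"])
      show "continuous_on ({- X..X} \<times> {a..t}) (\<lambda>(x, t). mass_left_of u x t - mass_left_of v x t)"
        using continuous_on_diff[OF U.cont_mass_left_of V.cont_mass_left_of] a t
        unfolding case_prod_unfold by (auto elim!: continuous_on_subset)
    next
      fix y s assume "a < s" "s \<le> t"
      then have s: "0 < s" "s < T" using a t by auto
      show "((\<lambda>y. mass_left_of u y s - mass_left_of v y s) has_real_derivative u y s - v y s) (at y)"
        by (intro DERIV_diff U.mass_left_of_x V.mass_left_of_x s)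
      show "((\<lambda>s. mass_left_of u y s - mass_left_of v y s) has_real_derivative
          (U.flux y s - f s) - (V.flux y s - f s)) (at s)"
        by (intro DERIV_diff U.mass_left_of_t V.mass_left_of_t s)
      assume "u y s - v y s = 0"
      \<comment> \<open>Where the solutions agree, the nonlinear coefficients coincide and
        \<open>f\<close> cancels, so the difference of the fluxes is linear in
        \<open>ux - vx\<close>.\<close>
      then have "(U.flux y s - f s) - (V.flux y s - f s) = u y s powr (m - 1) * (ux y s - vx y s)"
        by (simp add: algebra_simps)
      moreover have "((\<lambda>y. u y s - v y s) has_real_derivative ux y s - vx y s) (at y)"
        by (intro DERIV_diff U.u_x V.u_x s)
      ultimately show "\<exists>d c. ((\<lambda>y. u y s - v y s) has_real_derivative d) (at y) \<and> 0 \<le> c \<and>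
          (U.flux y s - f s) - (V.flux y s - f s) = c * d"
        by (meson powr_ge_zero)
    next
      fix y
      have i: "integrable lebesgue (\<lambda>x. u x a)" "integrable lebesgue (\<lambda>x. v x a)"
        using U.integrable_u V.integrable_u a \<open>a < T\<close> by auto
      have *: "set_integrable lebesgue {..y} h" if "integrable lebesgue h" for h :: "real \<Rightarrow> real"
        unfolding set_integrable_def by (rule integrable_mult_indicator) (use that in auto)
      have "mass_left_of u y a - mass_left_of v y a = (LINT z:{..y}|lebesgue. u z a - v z a)"
        unfolding mass_left_of_def by (rule set_integral_diff(2)[symmetric]) (intro * i)+
      also have "\<dots> \<le> (LINT z:{..y}|lebesgue. \<bar>u z a - v z a\<bar>)"
        by (intro set_integral_mono * integrable_abs Bochner_Integration.integrable_diff i) auto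
      also have "\<dots> \<le> (LINT z|lebesgue. \<bar>u z a - v z a\<bar>)"
        by (intro set_integral_atMost_le_total integrable_abs Bochner_Integration.integrable_diff i) auto
      finally show "mass_left_of u y a - mass_left_of v y a \<le> e" using a by simp
    next
      fix s assume s: "s \<in> {a..t}"
      then have s': "0 < s" "s < T" using a t by auto
      have nn: "0 \<le> u y s" "0 \<le> v y s" for y using U.pos[OF s'] V.pos[OF s'] by (auto intro: less_imp_le)
      \<comment> \<open>On the left side the mass of \<open>u\<close> is a small tail and that of
        \<open>v\<close> is nonnegative. On the right side the mass of \<open>u\<close> is at most
        \<open>N s\<close> and that of \<open>v\<close> exceeds \<open>N s - e\<close>; here the
        common total mass enters.\<close>
      show "mass_left_of u (-X) s - mass_left_of v (-X) s \<le> e"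
        using set_integral_atMost_tail(1)[OF U.integrable_u[OF s'] nn(1) X(4), of "-X"]
          set_integral_atMost_nonneg[OF V.integrable_u[OF s'] nn(2), of "-X"]
          U.integral_u[OF s'] X1(2)[OF X(1) s]
        by (simp add: mass_left_of_def)
      show "mass_left_of u X s - mass_left_of v X s \<le> e"
        using set_integral_atMost_tail(2)[OF V.integrable_u[OF s'] nn(2) X(4), of X]
          set_integral_atMost_le_total[OF U.integrable_u[OF s'] nn(1), of X]
          U.integral_u[OF s'] X2(2)[OF X(2) s]
        by (simp add: mass_left_of_def)
    qed (use a X t in auto)
  qed
  then have "mass_left_of u x t - mass_left_of v x t \<le> 0"
    by (rule field_le_epsilon) simp
  then show ?thesis by simp
qed

section \<open>Application to Cauchy solutions\<close>

lemma cauchy_solution_mass_losing_flow: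
  assumes "m \<noteq> 0" "cauchy_solution m u0 T u" "mass_identity u0 f T u" "decay_at_infinity m f T u"
    and f: "continuous_on {0..} f"
  obtains ux ut where "mass_losing_flow m T f
    (\<lambda>t. (LINT x|lebesgue. u0 x) - 2 * (LINT s:{0..t}|lebesgue. f s)) u ux ut"
proof -
  have "classical_solution m (UNIV \<times> {0<..<T}) u"
    using assms(2) by (simp add: cauchy_solution_def)
  from classical_solution_pressure[OF this \<open>m \<noteq> 0\<close>] obtain ux ut where
    "\<And>x t. 0 < t \<Longrightarrow> t < T \<Longrightarrow>
       ((\<lambda>y. u y t powr m / m) has_real_derivative u x t powr (m - 1) * ux x t) (at x)"
    "\<And>x t. 0 < t \<Longrightarrow> t < T \<Longrightarrow> 0 < u x t"
    "\<And>x t. 0 < t \<Longrightarrow> t < T \<Longrightarrow> ((\<lambda>y. u y t) has_real_derivative ux x t) (at x)"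
    "\<And>x t. 0 < t \<Longrightarrow> t < T \<Longrightarrow> ((\<lambda>s. u x s) has_real_derivative ut x t) (at t)"
    "\<And>x t. 0 < t \<Longrightarrow> t < T \<Longrightarrow>
       ((\<lambda>y. u y t powr (m - 1) * ux y t) has_real_derivative ut x t) (at x)"
    "continuous_on (UNIV \<times> {0<..<T}) (\<lambda>(x, t). u x t)"
    "continuous_on (UNIV \<times> {0<..<T}) (\<lambda>(x, t). ux x t)"
    "continuous_on (UNIV \<times> {0<..<T}) (\<lambda>(x, t). ut x t)" by blast
  moreover have "((LINT x|lebesgue. u0 x) - 2 * (LINT r:{0..t}|lebesgue. f r)) -
      ((LINT x|lebesgue. u0 x) - 2 * (LINT r:{0..s}|lebesgue. f r)) = - 2 * integral {s..t} f"
    if "0 < s" "s \<le> t" for s t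
  proof -
    have fi: "f integrable_on {0..r}" and fs: "(LINT \<tau>:{0..r}|lebesgue. f \<tau>) = integral {0..r} f" for r
    proof -
      have "f absolutely_integrable_on {0..r}"
        by (intro absolutely_integrable_continuous_real continuous_on_subset[OF f]) auto
      then show "f integrable_on {0..r}" "(LINT \<tau>:{0..r}|lebesgue. f \<tau>) = integral {0..r} f"
        by (auto intro: set_lebesgue_integral_eq_integral)
    qed
    show ?thesis
      using Henstock_Kurzweil_Integration.integral_combine[of 0 s t f] that fi[of t] by (simp add: fs)
  qed
  ultimately have "mass_losing_flow m T f
      (\<lambda>t. (LINT x|lebesgue. u0 x) - 2 * (LINT s:{0..t}|lebesgue. f s)) u ux ut"
    using assms unfolding mass_losing_flow_def mass_identity_def by auto
  then show thesis by (rule that)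
qed

text \<open>Triangle inequality through \<open>u0\<close>. It is carried out with nonnegative
  integrals, for which measurability of \<open>u0\<close> suffices, and transferred back because the
  difference of the two solutions is integrable.\<close>

lemma initial_condition_L1_diff:
  assumes "initial_condition UNIV u u0" "initial_condition UNIV v u0"
    and u0: "u0 \<in> borel_measurable lebesgue"
    and uv: "\<And>t. 0 < t \<Longrightarrow> t < T \<Longrightarrow> integrable lebesgue (\<lambda>x. u x t)"
      "\<And>t. 0 < t \<Longrightarrow> t < T \<Longrightarrow> integrable lebesgue (\<lambda>x. v x t)"
    and "0 < T" "0 < e"
  shows "\<forall>\<^sub>F t in at_right 0. (LINT x|lebesgue. \<bar>u x t - v x t\<bar>) < e"
proof -
  have "((\<lambda>t. (\<integral>\<^sup>+x. ennreal \<bar>u x t - u0 x\<bar> \<partial>lebesgue) +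
      (\<integral>\<^sup>+x. ennreal \<bar>v x t - u0 x\<bar> \<partial>lebesgue)) \<longlongrightarrow> 0 + 0) (at_right 0)"
    using assms(1,2) unfolding initial_condition_def by (intro tendsto_add) auto
  then have "\<forall>\<^sub>F t in at_right 0. (\<integral>\<^sup>+x. ennreal \<bar>u x t - u0 x\<bar> \<partial>lebesgue) +
      (\<integral>\<^sup>+x. ennreal \<bar>v x t - u0 x\<bar> \<partial>lebesgue) < ennreal e"
    by (rule order_tendstoD(2)) (use \<open>0 < e\<close> in simp)
  moreover have "\<forall>\<^sub>F t in at_right 0. t \<in> {0<..<T}"
    by (rule eventually_at_right_real[OF \<open>0 < T\<close>])
  ultimately show ?thesis
  proof eventually_elim
    case (elim t)
    then have i: "integrable lebesgue (\<lambda>x. u x t)" "integrable lebesgue (\<lambda>x. v x t)" using uv by auto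
    have [measurable]: "(\<lambda>x. u x t) \<in> borel_measurable lebesgue" "(\<lambda>x. v x t) \<in> borel_measurable lebesgue"
      using i by auto
    note [measurable] = u0
    have "ennreal (LINT x|lebesgue. \<bar>u x t - v x t\<bar>) = (\<integral>\<^sup>+x. ennreal \<bar>u x t - v x t\<bar> \<partial>lebesgue)"
      using i by (intro nn_integral_eq_integral[symmetric]) auto
    also have "\<dots> \<le> (\<integral>\<^sup>+x. ennreal \<bar>u x t - u0 x\<bar> + ennreal \<bar>v x t - u0 x\<bar> \<partial>lebesgue)"
      by (intro nn_integral_mono) (auto simp: ennreal_plus[symmetric] simp del: ennreal_plus)
    also have "\<dots> = (\<integral>\<^sup>+x. ennreal \<bar>u x t - u0 x\<bar> \<partial>lebesgue) +
        (\<integral>\<^sup>+x. ennreal \<bar>v x t - u0 x\<bar> \<partial>lebesgue)"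
      by (rule nn_integral_add) measurable
    also have "\<dots> < ennreal e" using elim by simp
    finally show ?case using \<open>0 < e\<close> by (simp add: ennreal_less_iff)
  qed
qed

theorem theorem4p8:
  fixes m \<mu>0 R0 T :: real
    and u0 f :: "real \<Rightarrow> real"
    and u ut :: "real \<Rightarrow> real \<Rightarrow> real"
  assumes "-1 < m" and "m < 0"
    and "u0 \<in> borel_measurable lebesgue"
    and "AE x in lebesgue. 0 \<le> u0 x"
    and "\<exists>C. AE x in lebesgue. \<bar>u0 x\<bar> \<le> C"
    and "\<mu>0 > 0" and "R0 > 1"
    and "AE x in lebesgue. \<bar>x\<bar> \<ge> R0 \<longrightarrow> u0 x \<le> (\<mu>0 * \<bar>m\<bar> * \<bar>x\<bar>) powr (1 / m)"
    and "continuous_on {0..} f" and "\<forall>t\<ge>0. 0 \<le> f t"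
    and "T > 0" and "2 * (LINT s:{0..T}|lebesgue. f s) = (LINT x|lebesgue. u0 x)"
    and "cauchy_solution m u0 T u"
    and "mass_identity u0 f T u"
    and "decay_at_infinity m f T u"
    and "cauchy_solution m u0 T ut"
    and "neumann_approximation m u0 f T ut"
    and "mass_identity u0 f T ut"
    and "decay_at_infinity m f T ut"
  shows "\<forall>x. \<forall>t\<in>{0<..<T}. u x t = ut x t"
proof (intro allI ballI)
  fix x t assume "t \<in> {0<..<T}"
  then have t: "0 < t" "t < T" by auto
  let ?N = "\<lambda>t. (LINT x|lebesgue. u0 x) - 2 * (LINT s:{0..t}|lebesgue. f s)"
  obtain p p' where "mass_losing_flow m T f ?N u p p'"
    using cauchy_solution_mass_losing_flow less_imp_neq[OF \<open>m < 0\<close>] assms(9,13-15) by blast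
  then interpret U: mass_losing_flow m T f ?N u p p' .
  obtain q q' where "mass_losing_flow m T f ?N ut q q'"
    using cauchy_solution_mass_losing_flow less_imp_neq[OF \<open>m < 0\<close>] assms(9,16,18,19) by blast
  then interpret V: mass_losing_flow m T f ?N ut q q' .
  have init: "initial_condition UNIV u u0" "initial_condition UNIV ut u0"
    using assms(13,16) by (auto simp: cauchy_solution_def)
  \<comment> \<open>The comparison is symmetric in the two solutions, so it is applied in both
    orders; equal masses to the left of every point have equal x-derivatives, which are the
    solutions themselves.\<close>
  have "mass_left_of u y t \<le> mass_left_of ut y t" for y
    by (rule mass_left_of_le[OF U.mass_losing_flow_axioms V.mass_losing_flow_axioms _ t])
       (rule initial_condition_L1_diff[OF init assms(3) U.integrable_u V.integrable_u \<open>T > 0\<close>])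
  moreover have "mass_left_of ut y t \<le> mass_left_of u y t" for y
    by (rule mass_left_of_le[OF V.mass_losing_flow_axioms U.mass_losing_flow_axioms _ t])
       (rule initial_condition_L1_diff[OF init(2,1) assms(3) V.integrable_u U.integrable_u \<open>T > 0\<close>])
  ultimately have "(\<lambda>y. mass_left_of u y t) = (\<lambda>y. mass_left_of ut y t)"
    by (intro ext antisym)
  then show "u x t = ut x t"
    using DERIV_unique[OF U.mass_left_of_x[OF t, of x]] V.mass_left_of_x[OF t, of x] by simp
qed

end
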